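(* Let $q\in\mathbb{Q}_s$. The Moore--Penrose inverse $q^\dagger$ of $q$ with respect to $\tau$, i.e. the unique scalar $q^\dagger\in\mathbb{Q}_s$ satisfying $$qq^\dagger q=q,\qquad q^\dagger qq^\dagger=q^\dagger,\qquad \tau(qq^\dagger)=qq^\dagger,\qquad \tau(q^\dagger q)=q^\dagger q,$$ is given by $$q^\dagger=\begin{cases}\dfrac{\overline q}{N(q)},&N(q)\neq0,\\[8pt] \dfrac{\tau(q)}{2\|q\|_{\mathrm E}^2},&N(q)=0,\ q\neq0,\\[8pt] 0,&q=0.\end{cases}$$ Moreover, $(q^\dagger)^\sigma=(q^\sigma)^\dagger$.
   Context: $\mathbb{Q}_s$ is the real algebra of split quaternions $q=q_1+q_2\mathbf{i}+q_3\mathbf{j}+q_4\mathbf{k}$ ($q_\ell\in\mathbb{R}$) with $\mathbf{i}^2=-1$, $\mathbf{j}^2=\mathbf{k}^2=1$, $\mathbf{i}\mathbf{j}=\mathbf{k}=-\mathbf{j}\mathbf{i}$, $\mathbf{j}\mathbf{k}=-\mathbf{i}=-\mathbf{k}\mathbf{j}$, $\mathbf{k}\mathbf{i}=\mathbf{j}=-\mathbf{i}\mathbf{k}$. For such $q$: $\overline q=q_1-q_2\mathbf{i}-q_3\mathbf{j}-q_4\mathbf{k}$ (full conjugate); $\tau(q)=q_1-q_2\mathbf{i}+q_3\mathbf{j}+q_4\mathbf{k}$ ($i$-conjugate); $N(q)=q\overline q=q_1^2+q_2^2-q_3^2-q_4^2$; $\|q\|_{\mathrm E}^2=q_1^2+q_2^2+q_3^2+q_4^2$;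 and $$q^\sigma=\begin{bmatrix} q_1+q_3 & -q_2+q_4 \\ q_2+q_4 & q_1-q_3 \end{bmatrix}\in\mathbb{R}^{2\times2}.$$ For a real matrix, $\dagger$ is the usual real Moore--Penrose inverse. *)

theory Defs
  imports "HOL-Analysis.Analysis"
begin

section \<open>Split quaternions\<close>

codatatype split_quat = SQuat (sq1: real) (sq2: real) (sq3: real) (sq4: real)

lemma split_quat_eq_iff:
  "p = q \<longleftrightarrow> sq1 p = sq1 q \<and> sq2 p = sq2 q \<and> sq3 p = sq3 q \<and> sq4 p = sq4 q"
  by (auto intro: split_quat.expand)

instantiation split_quat :: real_algebra_1
begin

primcorec zero_split_quat where
  "sq1 0 = 0" | "sq2 0 = 0" | "sq3 0 = 0" | "sq4 0 = 0"

primcorec one_split_quat where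
  "sq1 1 = 1" | "sq2 1 = 0" | "sq3 1 = 0" | "sq4 1 = 0"

primcorec uminus_split_quat where
  "sq1 (- p) = - sq1 p" | "sq2 (- p) = - sq2 p"
| "sq3 (- p) = - sq3 p" | "sq4 (- p) = - sq4 p"

primcorec plus_split_quat where
  "sq1 (p + q) = sq1 p + sq1 q" | "sq2 (p + q) = sq2 p + sq2 q"
| "sq3 (p + q) = sq3 p + sq3 q" | "sq4 (p + q) = sq4 p + sq4 q"

primcorec minus_split_quat where
  "sq1 (p - q) = sq1 p - sq1 q" | "sq2 (p - q) = sq2 p - sq2 q"
| "sq3 (p - q) = sq3 p - sq3 q" | "sq4 (p - q) = sq4 p - sq4 q"

primcorec scaleR_split_quat where
  "sq1 (r *\<^sub>R p) = r * sq1 p" | "sq2 (r *\<^sub>R p) = r * sq2 p"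
| "sq3 (r *\<^sub>R p) = r * sq3 p" | "sq4 (r *\<^sub>R p) = r * sq4 p"

text \<open>Bilinear extension of the multiplication table of the units, verified below.\<close>

primcorec times_split_quat where
  "sq1 (p * q) = sq1 p * sq1 q - sq2 p * sq2 q + sq3 p * sq3 q + sq4 p * sq4 q"
| "sq2 (p * q) = sq1 p * sq2 q + sq2 p * sq1 q - sq3 p * sq4 q + sq4 p * sq3 q"
| "sq3 (p * q) = sq1 p * sq3 q + sq3 p * sq1 q + sq4 p * sq2 q - sq2 p * sq4 q"
| "sq4 (p * q) = sq1 p * sq4 q + sq4 p * sq1 q + sq2 p * sq3 q - sq3 p * sq2 q"

instance
  by standard (auto simp: split_quat_eq_iff algebra_simps)

end

definition sq_i :: split_quat where "sq_i = SQuat 0 1 0 0"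
definition sq_j :: split_quat where "sq_j = SQuat 0 0 1 0"
definition sq_k :: split_quat where "sq_k = SQuat 0 0 0 1"

lemma split_quat_expand:
  "q = of_real (sq1 q) + sq2 q *\<^sub>R sq_i + sq3 q *\<^sub>R sq_j + sq4 q *\<^sub>R sq_k"
  by (simp add: split_quat_eq_iff of_real_def sq_i_def sq_j_def sq_k_def)

lemma sq_unit_products:
  "sq_i * sq_i = -1" "sq_j * sq_j = 1" "sq_k * sq_k = 1"
  "sq_i * sq_j = sq_k" "sq_j * sq_i = - sq_k"
  "sq_j * sq_k = - sq_i" "sq_k * sq_j = sq_i"
  "sq_k * sq_i = sq_j" "sq_i * sq_k = - sq_j"
  by (simp_all add: split_quat_eq_iff sq_i_def sq_j_def sq_k_def)

definition sq_conj :: "split_quat \<Rightarrow> split_quat" where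
  "sq_conj q = SQuat (sq1 q) (- sq2 q) (- sq3 q) (- sq4 q)"

definition sq_tau :: "split_quat \<Rightarrow> split_quat" where
  "sq_tau q = SQuat (sq1 q) (- sq2 q) (sq3 q) (sq4 q)"

definition sq_N :: "split_quat \<Rightarrow> real" where
  "sq_N q = (sq1 q)\<^sup>2 + (sq2 q)\<^sup>2 - (sq3 q)\<^sup>2 - (sq4 q)\<^sup>2"

lemma sq_mult_conj: "q * sq_conj q = of_real (sq_N q)"
  by (simp add: split_quat_eq_iff sq_conj_def sq_N_def of_real_def power2_eq_square)

definition sq_normE :: "split_quat \<Rightarrow> real" where
  "sq_normE q = sqrt ((sq1 q)\<^sup>2 + (sq2 q)\<^sup>2 + (sq3 q)\<^sup>2 + (sq4 q)\<^sup>2)"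

definition sq_sigma :: "split_quat \<Rightarrow> real^2^2" where
  "sq_sigma q = vector [vector [sq1 q + sq3 q, - sq2 q + sq4 q],
                        vector [sq2 q + sq4 q, sq1 q - sq3 q]]"

section \<open>Moore--Penrose inverses\<close>

definition is_tau_MP :: "split_quat \<Rightarrow> split_quat \<Rightarrow> bool" where
  "is_tau_MP q p \<longleftrightarrow> q * p * q = q \<and> p * q * p = p \<and>
     sq_tau (q * p) = q * p \<and> sq_tau (p * q) = p * q"

definition tau_MP :: "split_quat \<Rightarrow> split_quat" where
  "tau_MP q = (THE p. is_tau_MP q p)"

definition is_matrix_MP :: "real^'n^'m \<Rightarrow> real^'m^'n \<Rightarrow> bool" where
  "is_matrix_MP A X \<longleftrightarrow> A ** X ** A = A \<and> X ** A ** X = X \<and>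
     transpose (A ** X) = A ** X \<and> transpose (X ** A) = X ** A"

definition matrix_MP :: "real^'n^'m \<Rightarrow> real^'m^'n" where
  "matrix_MP A = (THE X. is_matrix_MP A X)"

text \<open>The real Moore--Penrose inverse is well defined for every matrix.\<close>

lemma is_matrix_MP_unique:
  assumes X: "is_matrix_MP A X" and Y: "is_matrix_MP A Y"
  shows "X = Y"
proof -
  note x = X[unfolded is_matrix_MP_def] and y = Y[unfolded is_matrix_MP_def]
  have "A ** X = transpose (A ** X)" using x by simp
  also have "\<dots> = transpose ((A ** Y) ** (A ** X))"
    using y by (simp add: matrix_mul_assoc)
  also have "\<dots> = (A ** X) ** (A ** Y)"
    using x y by (simp add: matrix_transpose_mul)
  also have "\<dots> = A ** Y"
    using x by (simp add: matrix_mul_assoc)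
  finally have AX: "A ** X = A ** Y" .
  have "X ** A = transpose (X ** A)" using x by simp
  also have "\<dots> = transpose (X ** (A ** Y ** A))" using y by simp
  also have "\<dots> = transpose ((X ** A) ** (Y ** A))" by (simp only: matrix_mul_assoc)
  also have "\<dots> = (Y ** A) ** (X ** A)"
    using x y by (simp add: matrix_transpose_mul)
  also have "\<dots> = Y ** (A ** X ** A)" by (simp only: matrix_mul_assoc)
  also have "\<dots> = Y ** A" using x by simp
  finally have XA: "X ** A = Y ** A" .
  have "X = X ** (A ** X)" using x by (simp add: matrix_mul_assoc)
  also have "\<dots> = Y ** A ** Y" by (simp add: AX matrix_mul_assoc XA)
  also have "\<dots> = Y" using y by simp
  finally show "X = Y" .
qed

lemma normal_equations_solvable:
  fixes A :: "real^'n^'m"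
  shows "\<exists>U. transpose A ** A ** U = transpose A"
proof -
  have ex: "\<exists>u. transpose A *v (A *v u) = transpose A *v v" for v
  proof -
    have sub: "subspace (range ((*v) A))"
      by (intro linear_subspace_image) auto
    obtain y z where y: "y \<in> span (range ((*v) A))"
      and z: "\<And>w. w \<in> span (range ((*v) A)) \<Longrightarrow> orthogonal z w" and v: "v = y + z"
      using orthogonal_subspace_decomp_exists[of "range ((*v) A)" v] by blast
    have "y \<in> range ((*v) A)" using y sub by (metis span_eq_iff)
    then obtain u where u: "y = A *v u" by blast
    have "(transpose A *v z) \<bullet> x = 0" for x
    proof -
      have "orthogonal z (A *v x)" by (rule z) (auto intro: span_base)
      then show ?thesis by (simp add: dot_lmul_matrix orthogonal_def)
    qed
    then have "transpose A *v z = 0" by (metis inner_eq_zero_iff)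
    then show ?thesis using u v by (auto simp: matrix_vector_right_distrib)
  qed
  then obtain f where f: "\<And>v. transpose A *v (A *v f v) = transpose A *v v" by metis
  define U :: "real^'m^'n" where "U = transpose (\<chi> j. f (axis j 1))"
  have "(transpose A ** A ** U) *v axis j 1 = transpose A *v axis j 1" for j
  proof -
    have "U *v axis j 1 = f (axis j 1)"
      by (simp add: U_def matrix_vector_mult_basis column_def vec_eq_iff transpose_def)
    then show ?thesis using f by (simp add: matrix_vector_mul_assoc[symmetric])
  qed
  then have "transpose A ** A ** U = transpose A"
    by (simp add: matrix_vector_mult_basis column_def vec_eq_iff)
  then show ?thesis by blast
qed

lemma is_matrix_MP_exists: "\<exists>X. is_matrix_MP A X"
proof -
  obtain U where U: "transpose A ** A ** U = transpose A"
    using normal_equations_solvable by blast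
  obtain V where V: "A ** transpose A ** V = A"
    using normal_equations_solvable[of "transpose A"] by auto
  define W where "W = transpose V"
  have U': "transpose U ** transpose A ** A = A"
    using arg_cong[OF U, of transpose] by (simp add: matrix_transpose_mul matrix_mul_assoc)
  have W': "W ** A ** transpose A = transpose A"
    using arg_cong[OF V, of transpose]
    by (simp add: matrix_transpose_mul matrix_mul_assoc W_def)
  have "A ** U = transpose U ** (transpose A ** A ** U)"
    by (simp add: matrix_mul_assoc U')
  then have AU: "transpose (A ** U) = A ** U"
    by (simp add: U matrix_transpose_mul)
  have "W ** A = W ** (A ** transpose A ** V)"
    by (simp only: V)
  also have "\<dots> = transpose A ** V"
    by (simp add: matrix_mul_assoc W')
  finally have WA: "transpose (W ** A) = W ** A"
    by (simp add: matrix_transpose_mul W_def)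
  have AUA: "A ** U ** A = A"
    using U' AU by (simp add: matrix_transpose_mul)
  have AWA: "A ** W ** A = A"
    using V WA by (simp add: matrix_transpose_mul W_def matrix_mul_assoc[symmetric])
  have AX: "A ** (W ** A ** U) = A ** U"
    by (simp add: matrix_mul_assoc AWA)
  have XA: "W ** A ** U ** A = W ** A"
    using arg_cong[OF AUA, of "(**) W"] by (simp add: matrix_mul_assoc)
  have "W ** A ** U ** A ** (W ** A ** U) = W ** (A ** W ** A) ** U"
    by (simp only: XA) (simp add: matrix_mul_assoc)
  then have "is_matrix_MP A (W ** A ** U)"
    unfolding is_matrix_MP_def by (simp add: AX XA AU WA AUA AWA)
  then show ?thesis ..
qed

lemma is_matrix_MP_matrix_MP: "is_matrix_MP A (matrix_MP A)"
  unfolding matrix_MP_def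
  using is_matrix_MP_exists[of A] is_matrix_MP_unique[of A] by (blast intro: theI2)

end

theory Submission
  imports Defs
begin

text \<open>The map \<open>\<sigma>\<close> is an injective algebra homomorphism into the real \<open>2 \<times> 2\<close> matrices that turns
  \<open>\<tau>\<close> into transposition, so the four \<open>\<tau>\<close>-Penrose equations for \<open>q\<close> are the usual ones for
  \<open>q\<^sup>\<sigma>\<close>, and uniqueness is inherited from matrices. When \<open>N(q) = 0\<close>, the matrix \<open>q\<^sup>\<sigma>\<close> has
  determinant zero, and \<open>\<tau>(q) / (2 \<parallel>q\<parallel>\<^sub>E\<^sup>2)\<close> is the familiar formula \<open>A\<^sup>T / tr (A A\<^sup>T)\<close> for the
  Moore--Penrose inverse of a matrix of rank one.\<close>

lemma sq_sigma_mult: "sq_sigma (p * q) = sq_sigma p ** sq_sigma q"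
  by (simp add: sq_sigma_def vec_eq_iff matrix_matrix_mult_def forall_2 sum_2 algebra_simps)

lemma sq_sigma_tau: "sq_sigma (sq_tau q) = transpose (sq_sigma q)"
  by (simp add: sq_sigma_def sq_tau_def vec_eq_iff transpose_def forall_2)

lemma inj_sq_sigma: "inj sq_sigma"
  by (rule injI) (auto simp: sq_sigma_def vec_eq_iff forall_2 split_quat_eq_iff)

lemma is_tau_MP_iff_is_matrix_MP: "is_tau_MP q p \<longleftrightarrow> is_matrix_MP (sq_sigma q) (sq_sigma p)"
  unfolding is_tau_MP_def is_matrix_MP_def
  by (simp flip: sq_sigma_mult sq_sigma_tau add: inj_eq[OF inj_sq_sigma])

lemma is_tau_MP_unique:
  assumes "is_tau_MP q p" "is_tau_MP q p'"
  shows "p = p'"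
  using assms is_matrix_MP_unique inj_sq_sigma
  by (auto simp: is_tau_MP_iff_is_matrix_MP dest: injD)

lemma sq_tau_tau [simp]: "sq_tau (sq_tau q) = q"
  by (simp add: sq_tau_def split_quat_eq_iff)

lemma sq_tau_mult: "sq_tau (p * q) = sq_tau q * sq_tau p"
  by (simp add: sq_tau_def split_quat_eq_iff algebra_simps)

lemma sq_tau_scaleR: "sq_tau (r *\<^sub>R q) = r *\<^sub>R sq_tau q"
  by (simp add: sq_tau_def split_quat_eq_iff)

lemma sq_tau_one [simp]: "sq_tau 1 = 1"
  by (simp add: sq_tau_def split_quat_eq_iff)

lemma sq_conj_mult: "sq_conj q * q = of_real (sq_N q)"
  by (simp add: split_quat_eq_iff sq_conj_def sq_N_def of_real_def power2_eq_square)

lemma sq_normE_power2: "(sq_normE q)\<^sup>2 = (sq1 q)\<^sup>2 + (sq2 q)\<^sup>2 + (sq3 q)\<^sup>2 + (sq4 q)\<^sup>2"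
  by (simp add: sq_normE_def)

lemma sq_normE_eq_0_iff: "sq_normE q = 0 \<longleftrightarrow> q = 0"
  by (auto simp: sq_normE_def split_quat_eq_iff add_nonneg_eq_0_iff)

text \<open>For \<open>A = q\<^sup>\<sigma>\<close>, this is the Cayley--Hamilton identity of \<open>A A\<^sup>T\<close> multiplied from the right
  by the inverse of \<open>A\<^sup>T\<close>.\<close>

lemma sq_mult_tau_mult:
  "q * sq_tau q * q = (2 * (sq_normE q)\<^sup>2) *\<^sub>R q - sq_N q *\<^sub>R sq_tau (sq_conj q)"
  unfolding sq_normE_power2
  by (simp add: split_quat_eq_iff sq_tau_def sq_conj_def sq_N_def power2_eq_square algebra_simps)

text \<open>Here \<open>q\<close> is invertible with the candidate as two-sided inverse, so both
  products are 1.\<close>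

lemma is_tau_MP_conj:
  assumes "sq_N q \<noteq> 0"
  shows "is_tau_MP q (sq_conj q /\<^sub>R sq_N q)"
  using assms by (simp add: is_tau_MP_def sq_mult_conj sq_conj_mult of_real_def sq_tau_scaleR)

text \<open>For \<open>sq_N q = 0\<close> the last term of \<open>sq_mult_tau_mult\<close> vanishes,
  leaving the first Penrose equation up to the factor \<open>c\<close>.\<close>

lemma is_tau_MP_tau:
  assumes "sq_N q = 0" "q \<noteq> 0"
  shows "is_tau_MP q (sq_tau q /\<^sub>R (2 * (sq_normE q)\<^sup>2))"
proof -
  define c where "c = 2 * (sq_normE q)\<^sup>2"
  have c: "c \<noteq> 0" using assms by (simp add: c_def sq_normE_eq_0_iff)
  have 1: "q * sq_tau q * q = c *\<^sub>R q"
    using assms by (simp add: sq_mult_tau_mult c_def)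
  have 2: "sq_tau q * q * sq_tau q = c *\<^sub>R sq_tau q"
    \<comment> \<open>\<open>sq_tau\<close> is an involution reversing products, so it turns the
      first equation into the second.\<close>
    using arg_cong[OF 1, of sq_tau] by (simp add: sq_tau_mult sq_tau_scaleR mult.assoc)
  show ?thesis
    unfolding c_def[symmetric] using c 1 2
    by (simp add: is_tau_MP_def sq_tau_scaleR sq_tau_mult)
qed

theorem proposition3p1:
  fixes q :: split_quat
  shows "(\<exists>!p. is_tau_MP q p) \<and>
    tau_MP q = (if sq_N q \<noteq> 0 then sq_conj q /\<^sub>R sq_N q
                else if q \<noteq> 0 then sq_tau q /\<^sub>R (2 * (sq_normE q)\<^sup>2)
                else 0) \<and>
    sq_sigma (tau_MP q) = matrix_MP (sq_sigma q)"
proof -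
  define p where "p = (if sq_N q \<noteq> 0 then sq_conj q /\<^sub>R sq_N q
                else if q \<noteq> 0 then sq_tau q /\<^sub>R (2 * (sq_normE q)\<^sup>2)
                else 0)"
  have "is_tau_MP 0 0"
    by (simp add: is_tau_MP_def sq_tau_def split_quat_eq_iff)
  then have p: "is_tau_MP q p"
    using is_tau_MP_conj is_tau_MP_tau by (auto simp only: p_def split: if_split)
  then have MP: "tau_MP q = p"
    unfolding tau_MP_def by (blast intro: is_tau_MP_unique)
  \<comment> \<open>Both sides are Moore--Penrose inverses of \<open>sq_sigma q\<close>.\<close>
  have "sq_sigma p = matrix_MP (sq_sigma q)"
    using p is_matrix_MP_matrix_MP is_matrix_MP_unique
    by (auto simp: is_tau_MP_iff_is_matrix_MP)
  with p MP show ?thesis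
    unfolding p_def[symmetric] by (auto intro: is_tau_MP_unique)
qed

end
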